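(* Let $H$ be a separable Hilbert space and let $\{x_n\}_{n\in\mathbb{N}}$ be a frame for $H$ consisting of nonzero elements, with associated analysis operator $C\colon H\to\ell^2$. Let $\alpha=\bigl(\frac{1}{\|x_n\|}\bigr)_{n\in\mathbb{N}}$. Then the following statements are equivalent. (a) $\bigl\{\frac{x_n}{\|x_n\|}\bigr\}$ is a Bessel sequence in $H$. (b) $\bigl\{\frac{x_n}{\|x_n\|}\bigr\}$ is a frame for $H$. (c) $\mathrm{Range}(C)\subseteq\mathrm{Dom}(D_\alpha)$ and $D_\alpha|_{\mathrm{Range}(C)}$ is ICR. (d) $\mathrm{Range}(C)\subseteq\mathrm{Dom}(D_\alpha)$.
   Context: A sequence $\{z_n\}$ in $H$ is a frame for $H$ if there are constants $0<A\le B$ with $A\|x\|^2\le\sum_n|\langle x,z_n\rangle|^2\le B\|x\|^2$ for all $x\in H$; it is a Bessel sequence if at least the upper inequality holds for some $B$. The analysis operator of a Bessel sequence $\{x_n\}$ is $C\colon H\to\ell^2$, $C(x)=(\langle x,x_n\rangle)_n$. For a sequence of scalars $c=(c_n)$, the diagonal operator $D_c$ has domain $\mathrm{Dom}(D_c)=\{(d_n)\in\ell^2: (c_nd_n)\in\ell^2\}$ and is given by $D_c(d_n)=(c_nd_n)\in\ell^2$. A linear operator $T$ between two Hilbert spaces is ICR (Injective Closed Range) if it is bounded, injective and has closed range; equivalently, $T$ is bounded and linear and there is $\delta>0$ with $\|Tx\|\ge\delta\|x\|$ for all $x$. *)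

theory Defs
  imports "HOL-Analysis.Analysis"
begin

section \<open>Scalar fields\<close>

text \<open>
  Real and complex Hilbert spaces are treated simultaneously.  Every \<open>x\<close> in a field of the
  class below is a root of \<open>X\<^sup>2 - (x + cj x) X + x * cj x\<close>, whose coefficients are real by
  \<open>mult_cj\<close> (applied to \<open>x\<close> and to \<open>x + 1\<close>).  Hence, up to isometric isomorphism, the real
  and the complex numbers with their usual conjugation are the only fields in this class.
\<close>

class rc_field = real_normed_field + banach +
  fixes cj :: "'a \<Rightarrow> 'a"
  assumes cj_add: "cj (x + y) = cj x + cj y"
    and cj_mult: "cj (x * y) = cj x * cj y"
    and cj_cj: "cj (cj x) = x"
    and mult_cj_scaleR: "x * cj x = (norm x)\<^sup>2 *\<^sub>R 1"

lemma mult_cj: "x * cj x = of_real ((norm x)\<^sup>2)" for x :: "'k::rc_field"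
  by (simp add: mult_cj_scaleR of_real_def)

instantiation real :: rc_field
begin
definition cj_real :: "real \<Rightarrow> real" where "cj_real x = x"
instance by standard (auto simp: cj_real_def power2_eq_square)
end

instantiation complex :: rc_field
begin
definition cj_complex :: "complex \<Rightarrow> complex" where "cj_complex x = cnj x"
instance
proof
  fix z w :: complex
  show "z * cj z = (norm z)\<^sup>2 *\<^sub>R 1"
    using complex_norm_square[of z] by (simp add: cj_complex_def scaleR_conv_of_real)
qed (simp_all add: cj_complex_def)
end

lemma norm_cj [simp]: "norm (cj x) = norm (x :: 'k::rc_field)"
proof (cases "x = 0")
  case True
  have "cj (0 :: 'k) + cj 0 = cj 0" by (metis add_0 cj_add)
  then show ?thesis using True by simp
next
  case False
  have "norm x * norm (cj x) = norm x * norm x"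
    using arg_cong[OF mult_cj[of x], of norm]
    by (simp only: norm_mult norm_of_real) (simp add: power2_eq_square)
  then show ?thesis using False by simp
qed


section \<open>Hilbert spaces\<close>

text \<open>
  Completeness is part of \<open>'h::banach\<close>.  The inner product is linear in its first argument.
\<close>

locale hilbert_space = vector_space scale
  for scale :: "'k::rc_field \<Rightarrow> 'h::banach \<Rightarrow> 'h" +
  fixes ip :: "'h \<Rightarrow> 'h \<Rightarrow> 'k"
  assumes scale_of_real: "scale (of_real r) x = r *\<^sub>R x"
    and ip_add_left: "ip (x + y) z = ip x z + ip y z"
    and ip_scale_left: "ip (scale c x) y = c * ip x y"
    and ip_commute: "ip x y = cj (ip y x)"
    and norm_ip: "of_real ((norm x)\<^sup>2) = ip x x"

lemma hilbert_space_real: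
  "hilbert_space scaleR (inner :: 'a::{real_inner,banach} \<Rightarrow> 'a \<Rightarrow> real)"
  by unfold_locales
    (simp_all add: cj_real_def inner_add_left inner_add_right inner_commute power2_norm_eq_inner
      scaleR_add_left scaleR_add_right)

lemma hilbert_space_complex: "hilbert_space (*) (\<lambda>x y :: complex. x * cnj y)"
proof
  show "of_real ((norm z)\<^sup>2) = z * cnj z" for z :: complex
    using complex_norm_square[of z] by simp
qed (simp_all add: cj_complex_def algebra_simps scaleR_conv_of_real)


section \<open>The space of square summable sequences\<close>

definition square_summable :: "(nat \<Rightarrow> 'k::real_normed_vector) \<Rightarrow> bool" where
  "square_summable d \<longleftrightarrow> summable (\<lambda>n. (norm (d n))\<^sup>2)"

typedef (overloaded) ('k::rc_field) ell2 = "{d :: nat \<Rightarrow> 'k. square_summable d}"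
  morphisms ell2_nth Abs_ell2
  by (rule exI[of _ "\<lambda>_. 0"]) (simp add: square_summable_def)

lemma square_summable_ell2_nth: "square_summable (ell2_nth d)"
  using ell2_nth by auto

lemma ell2_nth_Abs: "square_summable d \<Longrightarrow> ell2_nth (Abs_ell2 d) = d"
  by (simp add: Abs_ell2_inverse)

lemma ell2_eqI: "(\<And>n. ell2_nth d n = ell2_nth e n) \<Longrightarrow> d = e"
  by (metis ell2_nth_inject ext)

lemma square_summable_iff_L2_set_bounded:
  "square_summable d \<longleftrightarrow> (\<exists>c. \<forall>K. L2_set (\<lambda>n. norm (d n)) {..<K} \<le> c)"
proof
  assume s: "square_summable d"
  have "L2_set (\<lambda>n. norm (d n)) {..<K} \<le> sqrt (\<Sum>n. (norm (d n))\<^sup>2)" for K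
    unfolding L2_set_def
    by (rule real_sqrt_le_mono, rule sum_le_suminf)
      (use s in \<open>auto simp: square_summable_def\<close>)
  then show "\<exists>c. \<forall>K. L2_set (\<lambda>n. norm (d n)) {..<K} \<le> c" by blast
next
  assume "\<exists>c. \<forall>K. L2_set (\<lambda>n. norm (d n)) {..<K} \<le> c"
  then obtain c where c: "\<And>K. L2_set (\<lambda>n. norm (d n)) {..<K} \<le> c" by blast
  have "(\<Sum>n<K. (norm (d n))\<^sup>2) \<le> c\<^sup>2" for K
    using power_mono[OF c[of K], of 2] by (simp add: L2_set_def sum_nonneg)
  then show "square_summable d"
    unfolding square_summable_def by (intro summableI_nonneg_bounded[where x = "c\<^sup>2"]) auto
qed

lemma L2_set_bounded_imp_le:
  assumes "\<And>K. L2_set (\<lambda>n. norm (d n)) {..<K} \<le> c"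
  shows "square_summable d" "sqrt (\<Sum>n. (norm (d n))\<^sup>2) \<le> c"
proof -
  show s: "square_summable d"
    using assms square_summable_iff_L2_set_bounded by blast
  have "c \<ge> 0" using assms[of 0] by simp
  have "(\<Sum>n<K. (norm (d n))\<^sup>2) \<le> c\<^sup>2" for K
    using power_mono[OF assms[of K], of 2] by (simp add: L2_set_def sum_nonneg)
  then have "(\<Sum>n. (norm (d n))\<^sup>2) \<le> c\<^sup>2"
    using s unfolding square_summable_def by (intro suminf_le_const) auto
  then show "sqrt (\<Sum>n. (norm (d n))\<^sup>2) \<le> c"
    using \<open>c \<ge> 0\<close> by (simp add: real_le_lsqrt suminf_nonneg s[unfolded square_summable_def])
qed

lemma L2_set_norm_add_le:
  "L2_set (\<lambda>n. norm (d n + e n)) A \<le> L2_set (\<lambda>n. norm (d n)) A + L2_set (\<lambda>n. norm (e n)) A"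
proof -
  have "L2_set (\<lambda>n. norm (d n + e n)) A \<le> L2_set (\<lambda>n. norm (d n) + norm (e n)) A"
    by (rule L2_set_mono) (auto intro: norm_triangle_ineq)
  also have "\<dots> \<le> L2_set (\<lambda>n. norm (d n)) A + L2_set (\<lambda>n. norm (e n)) A"
    by (rule L2_set_triangle_ineq)
  finally show ?thesis .
qed

lemma L2_set_le_sqrt_suminf:
  "square_summable d \<Longrightarrow> L2_set (\<lambda>n. norm (d n)) {..<K} \<le> sqrt (\<Sum>n. (norm (d n))\<^sup>2)"
  unfolding L2_set_def square_summable_def
  by (rule real_sqrt_le_mono, rule sum_le_suminf) auto

lemma square_summable_add:
  assumes "square_summable d" "square_summable e"
  shows "square_summable (\<lambda>n. d n + e n)"
    "sqrt (\<Sum>n. (norm (d n + e n))\<^sup>2) \<le> sqrt (\<Sum>n. (norm (d n))\<^sup>2) + sqrt (\<Sum>n. (norm (e n))\<^sup>2)"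
proof -
  have *: "L2_set (\<lambda>n. norm (d n + e n)) {..<K}
      \<le> sqrt (\<Sum>n. (norm (d n))\<^sup>2) + sqrt (\<Sum>n. (norm (e n))\<^sup>2)" for K
    using L2_set_norm_add_le[of d e "{..<K}"] L2_set_le_sqrt_suminf[OF assms(1), of K]
      L2_set_le_sqrt_suminf[OF assms(2), of K] by linarith
  show "square_summable (\<lambda>n. d n + e n)"
    "sqrt (\<Sum>n. (norm (d n + e n))\<^sup>2) \<le> sqrt (\<Sum>n. (norm (d n))\<^sup>2) + sqrt (\<Sum>n. (norm (e n))\<^sup>2)"
    using L2_set_bounded_imp_le[of "\<lambda>n. d n + e n", OF *] by auto
qed

lemma square_summable_mult:
  "square_summable d \<Longrightarrow> square_summable (\<lambda>n. c * d n :: 'k::real_normed_field)"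
  by (simp add: square_summable_def norm_mult power_mult_distrib)

lemma square_summable_scaleR: "square_summable d \<Longrightarrow> square_summable (\<lambda>n. r *\<^sub>R d n)"
  by (simp add: square_summable_def power_mult_distrib)

lemma square_summable_uminus: "square_summable (\<lambda>n. - d n) = square_summable d"
  by (simp add: square_summable_def)

lemma square_summable_diff:
  "square_summable d \<Longrightarrow> square_summable e \<Longrightarrow> square_summable (\<lambda>n. d n - e n)"
  using square_summable_add(1)[of d "\<lambda>n. - e n"] by (simp add: square_summable_uminus)

definition ell2_scale :: "'k::rc_field \<Rightarrow> 'k ell2 \<Rightarrow> 'k ell2" where
  "ell2_scale c d = Abs_ell2 (\<lambda>n. c * ell2_nth d n)"

definition ell2_ip :: "'k::rc_field ell2 \<Rightarrow> 'k ell2 \<Rightarrow> 'k" where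
  "ell2_ip d e = (\<Sum>n. ell2_nth d n * cj (ell2_nth e n))"

instantiation ell2 :: (rc_field) real_vector
begin

definition zero_ell2 :: "'a ell2" where "zero_ell2 = Abs_ell2 (\<lambda>_. 0)"
definition plus_ell2 :: "'a ell2 \<Rightarrow> 'a ell2 \<Rightarrow> 'a ell2"
  where "plus_ell2 d e = Abs_ell2 (\<lambda>n. ell2_nth d n + ell2_nth e n)"
definition uminus_ell2 :: "'a ell2 \<Rightarrow> 'a ell2"
  where "uminus_ell2 d = Abs_ell2 (\<lambda>n. - ell2_nth d n)"
definition minus_ell2 :: "'a ell2 \<Rightarrow> 'a ell2 \<Rightarrow> 'a ell2"
  where "minus_ell2 d e = Abs_ell2 (\<lambda>n. ell2_nth d n - ell2_nth e n)"
definition scaleR_ell2 :: "real \<Rightarrow> 'a ell2 \<Rightarrow> 'a ell2"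
  where "scaleR_ell2 r d = Abs_ell2 (\<lambda>n. r *\<^sub>R ell2_nth d n)"
lemma ell2_nth_simps [simp]:
  "ell2_nth (0 :: 'a ell2) n = 0"
  "ell2_nth (d + e) n = ell2_nth d n + ell2_nth e n"
  "ell2_nth (- d) n = - ell2_nth d n"
  "ell2_nth (d - e) n = ell2_nth d n - ell2_nth e n"
  "ell2_nth (r *\<^sub>R d) n = r *\<^sub>R ell2_nth d n"
  unfolding zero_ell2_def plus_ell2_def uminus_ell2_def minus_ell2_def scaleR_ell2_def
  by (subst ell2_nth_Abs;
      simp add: square_summable_ell2_nth square_summable_add square_summable_diff
        square_summable_uminus square_summable_scaleR square_summable_def[of "\<lambda>_. 0"])+

instance
proof
  fix d e f :: "'a ell2" and r s :: real
  show "d + e + f = d + (e + f)" by (rule ell2_eqI) simp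
  show "d + e = e + d" by (rule ell2_eqI) simp
  show "0 + d = d" by (rule ell2_eqI) simp
  show "- d + d = 0" by (rule ell2_eqI) simp
  show "d - e = d + - e" by (rule ell2_eqI) simp
  show "r *\<^sub>R (d + e) = r *\<^sub>R d + r *\<^sub>R e" by (rule ell2_eqI) (simp add: scaleR_add_right)
  show "(r + s) *\<^sub>R d = r *\<^sub>R d + s *\<^sub>R d" by (rule ell2_eqI) (simp add: scaleR_add_left)
  show "r *\<^sub>R s *\<^sub>R d = (r * s) *\<^sub>R d" by (rule ell2_eqI) simp
  show "1 *\<^sub>R d = d" by (rule ell2_eqI) simp
qed

end

instantiation ell2 :: (rc_field) real_normed_vector
begin

definition norm_ell2 :: "'a ell2 \<Rightarrow> real"
  where "norm_ell2 d = sqrt (\<Sum>n. (norm (ell2_nth d n))\<^sup>2)"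
definition dist_ell2 :: "'a ell2 \<Rightarrow> 'a ell2 \<Rightarrow> real"
  where "dist_ell2 d e = norm (d - e)"
definition sgn_ell2 :: "'a ell2 \<Rightarrow> 'a ell2"
  where "sgn_ell2 d = d /\<^sub>R norm d"
definition uniformity_ell2 :: "('a ell2 \<times> 'a ell2) filter"
  where "uniformity_ell2 = (INF e\<in>{0<..}. principal {(x, y). dist x y < e})"
definition open_ell2 :: "'a ell2 set \<Rightarrow> bool"
  where "open_ell2 U \<longleftrightarrow> (\<forall>x\<in>U. \<forall>\<^sub>F (x', y) in uniformity. x' = x \<longrightarrow> y \<in> U)"

instance
proof
  fix d e :: "'a ell2" and r :: real
  have sm: "summable (\<lambda>n. (norm (ell2_nth d n))\<^sup>2)"
    using square_summable_ell2_nth[of d] by (simp add: square_summable_def)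
  show "dist d e = norm (d - e)" by (rule dist_ell2_def)
  show "sgn d = d /\<^sub>R norm d" by (rule sgn_ell2_def)
  show "(uniformity :: ('a ell2 \<times> 'a ell2) filter)
      = (INF e\<in>{0<..}. principal {(x, y). dist x y < e})"
    by (rule uniformity_ell2_def)
  show "open U \<longleftrightarrow> (\<forall>x\<in>U. \<forall>\<^sub>F (x', y) in uniformity. x' = x \<longrightarrow> y \<in> U)" for U :: "'a ell2 set"
    by (rule open_ell2_def)
  show "norm d = 0 \<longleftrightarrow> d = 0"
  proof
    assume "norm d = 0"
    then have "\<forall>n. (norm (ell2_nth d n))\<^sup>2 = 0"
      using suminf_eq_zero_iff[OF sm] by (simp add: norm_ell2_def)
    then show "d = 0" by (intro ell2_eqI) simp
  qed (simp add: norm_ell2_def)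
  show "norm (d + e) \<le> norm d + norm e"
    using square_summable_add(2)[OF square_summable_ell2_nth square_summable_ell2_nth]
    by (simp add: norm_ell2_def)
  show "norm (r *\<^sub>R d) = \<bar>r\<bar> * norm d"
    by (simp add: norm_ell2_def power_mult_distrib suminf_mult[OF sm] real_sqrt_mult)
qed

end

lemma norm_ell2_nth_le: "norm (ell2_nth d n) \<le> norm d"
proof -
  have "norm (ell2_nth d n) \<le> L2_set (\<lambda>n. norm (ell2_nth d n)) {..<Suc n}"
    using member_le_L2_set[of "{..<Suc n}" n "\<lambda>n. norm (ell2_nth d n)"] by auto
  also have "\<dots> \<le> norm d"
    using L2_set_le_sqrt_suminf[OF square_summable_ell2_nth] by (simp add: norm_ell2_def)
  finally show ?thesis .
qed

instance ell2 :: (rc_field) banach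
proof
  fix X :: "nat \<Rightarrow> 'a ell2"
  assume X: "Cauchy X"
  have "Cauchy (\<lambda>i. ell2_nth (X i) n)" for n
  proof (rule metric_CauchyI)
    fix \<epsilon> :: real assume "\<epsilon> > 0"
    then obtain M where M: "\<And>i j. i \<ge> M \<Longrightarrow> j \<ge> M \<Longrightarrow> dist (X i) (X j) < \<epsilon>"
      using metric_CauchyD[OF X] by blast
    have "dist (ell2_nth (X i) n) (ell2_nth (X j) n) < \<epsilon>" if "i \<ge> M" "j \<ge> M" for i j
      using M[OF that] norm_ell2_nth_le[of "X i - X j" n] by (simp add: dist_norm)
    then show "\<exists>M. \<forall>i\<ge>M. \<forall>j\<ge>M. dist (ell2_nth (X i) n) (ell2_nth (X j) n) < \<epsilon>" by blast
  qed
  then have "\<exists>l. (\<lambda>i. ell2_nth (X i) n) \<longlonglongrightarrow> l" for n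
    by (simp add: Cauchy_convergent_iff convergent_def)
  then obtain l where l: "\<And>n. (\<lambda>i. ell2_nth (X i) n) \<longlonglongrightarrow> l n" by metis
  have bd: "\<exists>M. \<forall>i\<ge>M. \<forall>K. L2_set (\<lambda>n. norm (ell2_nth (X i) n - l n)) {..<K} \<le> \<epsilon>"
    if "\<epsilon> > 0" for \<epsilon>
  proof -
    obtain M where M: "\<And>i j. i \<ge> M \<Longrightarrow> j \<ge> M \<Longrightarrow> dist (X i) (X j) < \<epsilon>"
      using metric_CauchyD[OF X \<open>\<epsilon> > 0\<close>] by blast
    have "L2_set (\<lambda>n. norm (ell2_nth (X i) n - l n)) {..<K} \<le> \<epsilon>" if "i \<ge> M" for i K
    proof (rule LIMSEQ_le_const2)
      show "(\<lambda>j. L2_set (\<lambda>n. norm (ell2_nth (X i) n - ell2_nth (X j) n)) {..<K})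
          \<longlonglongrightarrow> L2_set (\<lambda>n. norm (ell2_nth (X i) n - l n)) {..<K}"
        unfolding L2_set_def by (intro tendsto_intros l)
      have "L2_set (\<lambda>n. norm (ell2_nth (X i) n - ell2_nth (X j) n)) {..<K} \<le> \<epsilon>" if "j \<ge> M" for j
        using M[OF \<open>i \<ge> M\<close> that] L2_set_le_sqrt_suminf[OF square_summable_ell2_nth[of "X i - X j"], of K]
        by (simp add: dist_norm norm_ell2_def)
      then show "\<exists>N. \<forall>j\<ge>N. L2_set (\<lambda>n. norm (ell2_nth (X i) n - ell2_nth (X j) n)) {..<K} \<le> \<epsilon>"
        by blast
    qed
    then show ?thesis by blast
  qed
  obtain M where M: "\<And>K. L2_set (\<lambda>n. norm (ell2_nth (X M) n - l n)) {..<K} \<le> 1"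
    using bd[of 1] by auto
  have "square_summable (\<lambda>n. ell2_nth (X M) n - (ell2_nth (X M) n - l n))"
    by (intro square_summable_diff square_summable_ell2_nth L2_set_bounded_imp_le(1)[OF M])
  then have nth: "ell2_nth (Abs_ell2 l) = l" by (simp add: ell2_nth_Abs)
  have "X \<longlonglongrightarrow> Abs_ell2 l"
  proof (rule metric_LIMSEQ_I)
    fix \<epsilon> :: real assume "\<epsilon> > 0"
    then obtain M where M: "\<And>i K. i \<ge> M \<Longrightarrow> L2_set (\<lambda>n. norm (ell2_nth (X i) n - l n)) {..<K} \<le> \<epsilon> / 2"
      using bd[of "\<epsilon> / 2"] by auto
    have "dist (X i) (Abs_ell2 l) \<le> \<epsilon> / 2" if "i \<ge> M" for i
      using L2_set_bounded_imp_le(2)[OF M[OF that]] by (simp add: dist_norm norm_ell2_def nth)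
    then show "\<exists>M. \<forall>i\<ge>M. dist (X i) (Abs_ell2 l) < \<epsilon>"
      using \<open>\<epsilon> > 0\<close> by (intro exI[of _ M]) fastforce
  qed
  then show "convergent X" by (auto simp: convergent_def)
qed

lemma ell2_nth_scale [simp]: "ell2_nth (ell2_scale c d) n = c * ell2_nth d n"
  unfolding ell2_scale_def
  by (subst ell2_nth_Abs) (rule square_summable_mult square_summable_ell2_nth refl)+

lemma summable_ell2_ip: "summable (\<lambda>n. ell2_nth d n * cj (ell2_nth e n))"
proof (rule summable_comparison_test')
  show "summable (\<lambda>n. (norm (ell2_nth d n))\<^sup>2 + (norm (ell2_nth e n))\<^sup>2)"
    using square_summable_ell2_nth[of d] square_summable_ell2_nth[of e]
    by (intro summable_add) (auto simp: square_summable_def)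
  fix n
  have "2 * (norm (ell2_nth d n) * norm (ell2_nth e n))
      \<le> (norm (ell2_nth d n))\<^sup>2 + (norm (ell2_nth e n))\<^sup>2"
    using sum_squares_bound[of "norm (ell2_nth d n)" "norm (ell2_nth e n)"] by simp
  moreover have "0 \<le> norm (ell2_nth d n) * norm (ell2_nth e n)" by simp
  ultimately show "norm (ell2_nth d n * cj (ell2_nth e n))
      \<le> (norm (ell2_nth d n))\<^sup>2 + (norm (ell2_nth e n))\<^sup>2"
    unfolding norm_mult norm_cj by linarith
qed

lemma cj_of_real: "cj (of_real r) = (of_real r :: 'k::rc_field)"
proof (cases "r = 0")
  case True
  then show ?thesis by (metis norm_cj norm_eq_zero of_real_0)
next
  case False
  have "of_real r * cj (of_real r :: 'k) = of_real r * of_real r"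
    by (simp add: mult_cj power2_eq_square)
  then show ?thesis using False by simp
qed

lemma bounded_linear_cj: "bounded_linear (cj :: 'k::rc_field \<Rightarrow> 'k)"
  by (rule bounded_linear_intro[where K = 1])
    (simp_all add: cj_add cj_mult cj_of_real scaleR_conv_of_real)

theorem hilbert_space_ell2: "hilbert_space ell2_scale (ell2_ip :: 'k::rc_field ell2 \<Rightarrow> _)"
proof
  fix c c' :: 'k and d e f :: "'k ell2" and r :: real
  show "ell2_scale c (d + e) = ell2_scale c d + ell2_scale c e"
    by (rule ell2_eqI) (simp add: algebra_simps)
  show "ell2_scale (c + c') d = ell2_scale c d + ell2_scale c' d"
    by (rule ell2_eqI) (simp add: algebra_simps)
  show "ell2_scale c (ell2_scale c' d) = ell2_scale (c * c') d" by (rule ell2_eqI) simp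
  show "ell2_scale 1 d = d" by (rule ell2_eqI) simp
  show "ell2_scale (of_real r) d = r *\<^sub>R d" by (rule ell2_eqI) (simp add: scaleR_conv_of_real)
  show "ell2_ip (d + e) f = ell2_ip d f + ell2_ip e f"
    by (simp add: ell2_ip_def distrib_right suminf_add[OF summable_ell2_ip summable_ell2_ip])
  show "ell2_ip (ell2_scale c d) e = c * ell2_ip d e"
    by (simp add: ell2_ip_def mult.assoc suminf_mult[OF summable_ell2_ip])
  show "ell2_ip d e = cj (ell2_ip e d)"
    by (simp add: ell2_ip_def bounded_linear.suminf[OF bounded_linear_cj summable_ell2_ip]
        cj_mult cj_cj mult.commute)
  have sm: "summable (\<lambda>n. (norm (ell2_nth d n))\<^sup>2)"
    using square_summable_ell2_nth[of d] by (simp add: square_summable_def)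
  show "of_real ((norm d)\<^sup>2) = ell2_ip d d"
    using suminf_of_real[OF sm, where 'a = 'k]
    by (simp add: ell2_ip_def mult_cj norm_ell2_def suminf_nonneg[OF sm])
qed


section \<open>Frames, analysis operators and diagonal operators\<close>

text \<open>
  Summability is stated explicitly, since \<^const>\<open>suminf\<close> carries no information about
  divergent series.
\<close>

definition bessel_seq :: "('h \<Rightarrow> 'h \<Rightarrow> 'k::rc_field) \<Rightarrow> (nat \<Rightarrow> 'h::real_normed_vector) \<Rightarrow> bool" where
  "bessel_seq ip z \<longleftrightarrow>
     (\<exists>B. \<forall>x. summable (\<lambda>n. (norm (ip x (z n)))\<^sup>2) \<and>
              (\<Sum>n. (norm (ip x (z n)))\<^sup>2) \<le> B * (norm x)\<^sup>2)"

definition frame :: "('h \<Rightarrow> 'h \<Rightarrow> 'k::rc_field) \<Rightarrow> (nat \<Rightarrow> 'h::real_normed_vector) \<Rightarrow> bool" where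
  "frame ip z \<longleftrightarrow>
     (\<exists>A B. 0 < A \<and> A \<le> B \<and>
        (\<forall>x. summable (\<lambda>n. (norm (ip x (z n)))\<^sup>2) \<and>
             A * (norm x)\<^sup>2 \<le> (\<Sum>n. (norm (ip x (z n)))\<^sup>2) \<and>
             (\<Sum>n. (norm (ip x (z n)))\<^sup>2) \<le> B * (norm x)\<^sup>2))"

text \<open>Meaningful only if \<open>z\<close> is a Bessel sequence, and the diagonal operator only on its domain.\<close>

definition analysis_op :: "('h \<Rightarrow> 'h \<Rightarrow> 'k::rc_field) \<Rightarrow> (nat \<Rightarrow> 'h) \<Rightarrow> 'h \<Rightarrow> 'k ell2" where
  "analysis_op ip z x = Abs_ell2 (\<lambda>n. ip x (z n))"

definition diag_dom :: "(nat \<Rightarrow> 'k::rc_field) \<Rightarrow> 'k ell2 set" where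
  "diag_dom c = {d. square_summable (\<lambda>n. c n * ell2_nth d n)}"

definition diag_op :: "(nat \<Rightarrow> 'k::rc_field) \<Rightarrow> 'k ell2 \<Rightarrow> 'k ell2" where
  "diag_op c d = Abs_ell2 (\<lambda>n. c n * ell2_nth d n)"

text \<open>
  \<open>ICR_on s1 s2 S T\<close>: the restriction of \<open>T\<close> to the subspace \<open>S\<close> is a bounded injective linear
  operator with closed range, where \<open>s1\<close> and \<open>s2\<close> are the scalar multiplications of the domain
  and of the codomain.
\<close>

definition ICR_on ::
  "('k::rc_field \<Rightarrow> 'a \<Rightarrow> 'a) \<Rightarrow> ('k \<Rightarrow> 'b \<Rightarrow> 'b) \<Rightarrow> 'a::real_normed_vector set \<Rightarrow>
   ('a \<Rightarrow> 'b::real_normed_vector) \<Rightarrow> bool" where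
  "ICR_on s1 s2 S T \<longleftrightarrow>
     module.subspace s1 S \<and>
     (\<forall>x\<in>S. \<forall>y\<in>S. T (x + y) = T x + T y) \<and>
     (\<forall>c. \<forall>x\<in>S. T (s1 c x) = s2 c (T x)) \<and>
     (\<exists>K. \<forall>x\<in>S. norm (T x) \<le> K * norm x) \<and>
     inj_on T S \<and>
     closed (T ` S)"

end

theory Submission
  imports Defs
begin

text \<open>
  Write \<open>y n = x n /\<^sub>R norm (x n)\<close>.  Testing the upper frame bound \<open>B\<close> on \<open>x n\<close> itself gives
  \<open>(norm (x n))\<^sup>2 \<le> B\<close>, so the coefficients against \<open>y n\<close> dominate those against \<open>x n\<close> up to
  the factor \<open>B\<close>, and the lower frame bound passes from \<open>x\<close> to \<open>y\<close> for free.  As \<open>D\<^sub>\<alpha> C\<close> is the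
  analysis operator of \<open>y\<close>, the frame bounds of \<open>y\<close> make it bounded below, whence its range is
  closed.  Finally \<open>Range(C) \<subseteq> Dom(D\<^sub>\<alpha>)\<close> says only that the coefficients against \<open>y\<close>
  are square summable for every vector; the uniform bound comes from the Baire category theorem.
\<close>

section \<open>Uniform boundedness for families of seminorms\<close>

lemma uniform_boundedness_seminorms:
  fixes p :: "'i \<Rightarrow> 'a::banach \<Rightarrow> real"
  assumes cont: "\<And>i. continuous_on UNIV (p i)"
    and diff: "\<And>i a b. p i (a - b) \<le> p i a + p i b"
    and scaleR: "\<And>i r a. p i (r *\<^sub>R a) = \<bar>r\<bar> * p i a"
    and ptw: "\<And>a. \<exists>c. \<forall>i. p i a \<le> c"
  shows "\<exists>K. \<forall>i a. p i a \<le> K * norm a"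
proof -
  define E where "E n = {a. \<forall>i. p i a \<le> real n}" for n :: nat
  have closed_E: "closed (E n)" for n
  proof -
    have "E n = (\<Inter>i. {a. p i a \<le> real n})" by (auto simp: E_def)
    moreover have "closed {a. p i a \<le> real n}" for i
      by (intro closed_Collect_le cont continuous_intros)
    ultimately show ?thesis by auto
  qed
  have "\<Union> (range E) = UNIV"
  proof -
    have "\<exists>n. a \<in> E n" for a
    proof -
      obtain c where c: "\<And>i. p i a \<le> c" using ptw by blast
      obtain n where "c \<le> real n" using real_arch_simple by blast
      then have "a \<in> E n" using c order_trans unfolding E_def by blast
      then show ?thesis ..
    qed
    then show ?thesis by auto
  qed
  \<comment> \<open>Baire: a countable union of closed sets with empty interior has empty interior.
    The union of the \<open>E n\<close> is the whole space, so some \<open>E n\<close> must contain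
    a ball.\<close>
  moreover have "interior (\<Union> (range E)) = {}" if "\<And>n. interior (E n) = {}"
    using Baire_category_alt[of "euclidean :: 'a topology" "range E"] closed_E that
      completely_metrizable_space_euclidean by auto
  ultimately have "\<exists>n. interior (E n) \<noteq> {}" by auto
  then obtain n a0 r where r: "r > 0" "cball a0 r \<subseteq> E n"
    unfolding mem_interior_cball ex_in_conv[symmetric] by blast
  \<comment> \<open>Stretch \<open>a\<close> to a vector \<open>b\<close> of norm \<open>r\<close>.
    Then \<open>b\<close> is the difference of \<open>a0 + b\<close> and \<open>a0\<close>, both in
    \<open>E n\<close>, which gives \<open>2 * real n\<close>; scaling back divides by
    \<open>r\<close>.\<close>
  have "p i a \<le> (2 * real n / r) * norm a" for i a
  proof (cases "a = 0")
    case True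
    then show ?thesis using scaleR[of i 0 0] by simp
  next
    case False
    define b where "b = (r / norm a) *\<^sub>R a"
    have "norm b = r" using False r by (simp add: b_def)
    then have "a0 + b \<in> E n" "a0 \<in> E n" using r by (auto simp: dist_norm subset_iff)
    then have "p i b \<le> 2 * real n"
      using diff[of i "a0 + b" a0] by (auto simp: E_def dest!: spec[of _ i])
    moreover have "p i b = (r / norm a) * p i a"
      using r by (simp add: b_def scaleR)
    ultimately show ?thesis using r False by (simp add: field_simps)
  qed
  then show ?thesis by blast
qed

section \<open>Coefficient sequences and constants extracted from the definitions\<close>

lemma diag_op_analysis_op:
  assumes "square_summable (\<lambda>n. ip h (z n))"
  shows "diag_op c (analysis_op ip z h) = Abs_ell2 (\<lambda>n. c n * ip h (z n))"
  by (simp add: diag_op_def analysis_op_def ell2_nth_Abs assms)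

lemma analysis_op_in_diag_dom_iff:
  assumes "square_summable (\<lambda>n. ip h (z n))"
  shows "analysis_op ip z h \<in> diag_dom c \<longleftrightarrow> square_summable (\<lambda>n. c n * ip h (z n))"
  by (simp add: diag_dom_def analysis_op_def ell2_nth_Abs assms)

lemma power2_norm_ell2: "(norm d)\<^sup>2 = (\<Sum>n. (norm (ell2_nth d n))\<^sup>2)"
  using square_summable_ell2_nth[of d]
  by (simp add: norm_ell2_def suminf_nonneg square_summable_def)

lemma frame_imp_bessel_seq: "frame ip z \<Longrightarrow> bessel_seq ip z"
  unfolding frame_def bessel_seq_def by blast

lemma frame_lower_bound:
  assumes "frame ip z"
  obtains A where "A > 0" "\<And>h. A * (norm h)\<^sup>2 \<le> (\<Sum>n. (norm (ip h (z n)))\<^sup>2)"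
proof -
  from assms obtain A B where "0 < A" and
    "\<forall>h. summable (\<lambda>n. (norm (ip h (z n)))\<^sup>2) \<and>
       A * (norm h)\<^sup>2 \<le> (\<Sum>n. (norm (ip h (z n)))\<^sup>2) \<and>
       (\<Sum>n. (norm (ip h (z n)))\<^sup>2) \<le> B * (norm h)\<^sup>2"
    unfolding frame_def by (elim exE conjE)
  then show thesis by (intro that[of A]) simp_all
qed

lemma bessel_seq_imp_square_summable: "bessel_seq ip z \<Longrightarrow> square_summable (\<lambda>n. ip h (z n))"
  unfolding bessel_seq_def square_summable_def by blast

lemma bessel_seq_bound:
  assumes "bessel_seq ip z"
  obtains B where "B > 0" "\<And>h. (\<Sum>n. (norm (ip h (z n)))\<^sup>2) \<le> B * (norm h)\<^sup>2"
proof -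
  obtain B where B: "\<And>h. (\<Sum>n. (norm (ip h (z n)))\<^sup>2) \<le> B * (norm h)\<^sup>2"
    using assms unfolding bessel_seq_def by blast
  \<comment> \<open>The definition of a Bessel sequence puts no sign on its constant; taking the
    maximum with 1 makes it positive, so that it can serve as a divisor later.\<close>
  have "(\<Sum>n. (norm (ip h (z n)))\<^sup>2) \<le> max B 1 * (norm h)\<^sup>2" for h
    using B[of h] mult_right_mono[of B "max B 1" "(norm h)\<^sup>2"] by simp
  then show thesis using that[of "max B 1"] by simp
qed

context hilbert_space
begin

section \<open>Sesquilinearity and the Cauchy-Schwarz inequality\<close>

lemma ip_scale_right: "ip x (scale c y) = cj c * ip x y"
  by (metis ip_commute ip_scale_left cj_mult cj_cj)

lemma ip_scaleR_left: "ip (r *\<^sub>R x) y = r *\<^sub>R ip x y"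
  using ip_scale_left[of "of_real r" x y] by (simp add: scale_of_real scaleR_conv_of_real)

lemma ip_scaleR_right: "ip x (r *\<^sub>R y) = r *\<^sub>R ip x y"
  using ip_scale_right[of x "of_real r" y]
  by (simp add: scale_of_real scaleR_conv_of_real cj_of_real)

lemma ip_diff_left: "ip (x - y) z = ip x z - ip y z"
  using ip_add_left[of "x - y" y z] by simp

lemma ip_diff_right: "ip x (y - z) = ip x y - ip x z"
proof -
  have "cj (a - b) = cj a - cj b" for a b :: 'k
    using cj_add[of "a - b" b] by simp
  then show ?thesis by (metis ip_commute ip_diff_left)
qed

lemma ip_mult_ip_commute: "ip x y * ip y x = of_real ((norm (ip x y))\<^sup>2)"
  using mult_cj[of "ip x y"] ip_commute[of y x] by simp

lemma norm_ip_le: "norm (ip x y) \<le> norm x * norm y"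
proof (cases "y = 0")
  case True
  then show ?thesis using ip_scaleR_right[of x 0 0] by simp
next
  case False
  \<comment> \<open>\<open>w\<close> is the component of \<open>x\<close> orthogonal to
    \<open>y\<close>, multiplied by the square of \<open>norm y\<close> to avoid division.
    Orthogonality leaves only the \<open>x\<close> part in the second argument of
    \<open>ip w w\<close>, and the inequality is the nonnegativity of the result.\<close>
  define w where "w = (norm y)\<^sup>2 *\<^sub>R x - scale (ip x y) y"
  have "ip w y = 0"
    by (simp add: w_def ip_diff_left ip_scaleR_left ip_scale_left norm_ip[symmetric]
        scaleR_conv_of_real)
  then have "ip w w = (norm y)\<^sup>2 *\<^sub>R ip w x"
    unfolding w_def[symmetric]
    by (subst (2) w_def) (simp add: ip_diff_right ip_scaleR_right ip_scale_right)
  also have "ip w x = of_real ((norm y)\<^sup>2 * (norm x)\<^sup>2 - (norm (ip x y))\<^sup>2)"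
    by (simp add: w_def ip_diff_left ip_scaleR_left ip_scale_left norm_ip[symmetric]
        ip_mult_ip_commute scaleR_conv_of_real)
  finally have "of_real ((norm w)\<^sup>2)
      = (of_real ((norm y)\<^sup>2 * ((norm y)\<^sup>2 * (norm x)\<^sup>2 - (norm (ip x y))\<^sup>2)) :: 'k)"
    by (simp add: norm_ip[symmetric] scaleR_conv_of_real)
  then have "(norm w)\<^sup>2 = (norm y)\<^sup>2 * ((norm y)\<^sup>2 * (norm x)\<^sup>2 - (norm (ip x y))\<^sup>2)"
    by (simp only: of_real_eq_iff)
  then have "0 \<le> (norm y)\<^sup>2 * ((norm y)\<^sup>2 * (norm x)\<^sup>2 - (norm (ip x y))\<^sup>2)"
    by (metis zero_le_power2)
  then have "(norm (ip x y))\<^sup>2 \<le> (norm x * norm y)\<^sup>2"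
    using False by (simp add: zero_le_mult_iff power_mult_distrib mult.commute)
  then show ?thesis by (rule power2_le_imp_le) simp
qed

lemma bounded_linear_ip_left: "bounded_linear (\<lambda>x. ip x y)"
  by (rule bounded_linear_intro[where K = "norm y"])
    (auto simp: ip_add_left ip_scaleR_left norm_ip_le)

text \<open>Uniform boundedness is applied to the l2 norms \<open>p K\<close> of the first
  \<open>K\<close> coefficients. Each is continuous as a finite expression in the continuous
  functionals \<open>ip _ (z n)\<close>, and square summability at \<open>h\<close> is exactly their
  boundedness at \<open>h\<close>.\<close>

lemma bessel_seqI_square_summable:
  assumes "\<And>h. square_summable (\<lambda>n. ip h (z n))"
  shows "bessel_seq ip z"
proof -
  define p where "p K h = L2_set (\<lambda>n. norm (ip h (z n))) {..<K}" for K :: nat and h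
  have "\<exists>M. \<forall>K h. p K h \<le> M * norm h"
  proof (rule uniform_boundedness_seminorms)
    fix K :: nat and h g :: 'h and r :: real
    show "continuous_on UNIV (p K)"
      unfolding p_def L2_set_def
      by (intro continuous_intros bounded_linear.continuous_on[OF bounded_linear_ip_left])
    show "p K (h - g) \<le> p K h + p K g"
      using L2_set_norm_add_le[of "\<lambda>n. ip h (z n)" "\<lambda>n. - ip g (z n)" "{..<K}"]
      by (simp add: p_def ip_diff_left)
    show "p K (r *\<^sub>R h) = \<bar>r\<bar> * p K h"
      by (simp add: p_def ip_scaleR_left L2_set_right_distrib)
    show "\<exists>c. \<forall>K. p K h \<le> c"
      using assms[of h] unfolding p_def square_summable_iff_L2_set_bounded .
  qed
  then obtain M where M: "\<And>K h. p K h \<le> M * norm h" by blast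
  have "(\<Sum>n. (norm (ip h (z n)))\<^sup>2) \<le> M\<^sup>2 * (norm h)\<^sup>2" for h
  proof -
    have "0 \<le> M * norm h" using M[of 0 h] by (simp add: p_def)
    moreover have "sqrt (\<Sum>n. (norm (ip h (z n)))\<^sup>2) \<le> M * norm h"
      using L2_set_bounded_imp_le(2)[of "\<lambda>n. ip h (z n)"] M[of _ h] by (simp add: p_def)
    ultimately show ?thesis
      by (metis power_mult_distrib sqrt_le_D)
  qed
  then show ?thesis
    using assms unfolding bessel_seq_def square_summable_def by blast
qed

section \<open>Analysis operators of Bessel sequences and frames\<close>

lemma ell2_nth_analysis_op:
  "bessel_seq ip z \<Longrightarrow> ell2_nth (analysis_op ip z h) n = ip h (z n)"
  by (simp add: analysis_op_def ell2_nth_Abs bessel_seq_imp_square_summable)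

lemma power2_norm_analysis_op:
  "bessel_seq ip z \<Longrightarrow> (norm (analysis_op ip z h))\<^sup>2 = (\<Sum>n. (norm (ip h (z n)))\<^sup>2)"
  by (simp add: power2_norm_ell2 ell2_nth_analysis_op)

lemma analysis_op_add:
  "bessel_seq ip z \<Longrightarrow> analysis_op ip z (g + h) = analysis_op ip z g + analysis_op ip z h"
  by (rule ell2_eqI) (simp add: ell2_nth_analysis_op ip_add_left)

lemma analysis_op_scale:
  "bessel_seq ip z \<Longrightarrow> analysis_op ip z (scale c h) = ell2_scale c (analysis_op ip z h)"
  by (rule ell2_eqI) (simp add: ell2_nth_analysis_op ip_scale_left)

lemma bounded_linear_analysis_op:
  assumes z: "bessel_seq ip z"
  shows "bounded_linear (analysis_op ip z)"
proof -
  obtain B where B: "B > 0" "\<And>h. (\<Sum>n. (norm (ip h (z n)))\<^sup>2) \<le> B * (norm h)\<^sup>2"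
    using bessel_seq_bound[OF z] by blast
  have "norm (analysis_op ip z h) \<le> norm h * sqrt B" for h
  proof (rule power2_le_imp_le)
    show "(norm (analysis_op ip z h))\<^sup>2 \<le> (norm h * sqrt B)\<^sup>2"
      using B(1) B(2)[of h]
      by (simp add: power2_norm_analysis_op z power_mult_distrib mult.commute)
  qed (use B(1) in simp)
  then show ?thesis
    by (intro bounded_linear_intro[where K = "sqrt B"])
      (simp_all add: analysis_op_add z ell2_eqI ell2_nth_analysis_op ip_scaleR_left)
qed

lemma frame_bounded_below:
  assumes z: "frame ip z"
  obtains \<delta> where "\<delta> > 0" "\<And>h. \<delta> * norm h \<le> norm (analysis_op ip z h)"
proof -
  obtain A where A: "A > 0" "\<And>h. A * (norm h)\<^sup>2 \<le> (\<Sum>n. (norm (ip h (z n)))\<^sup>2)"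
    using frame_lower_bound[OF z] by blast
  have "sqrt A * norm h \<le> norm (analysis_op ip z h)" for h
  proof (rule power2_le_imp_le)
    show "(sqrt A * norm h)\<^sup>2 \<le> (norm (analysis_op ip z h))\<^sup>2"
      using A(1) A(2)[of h]
      by (simp add: power2_norm_analysis_op frame_imp_bessel_seq[OF z] power_mult_distrib)
  qed simp
  then show thesis using that[of "sqrt A"] A by simp
qed

text \<open>An operator that is bounded below pulls Cauchy sequences of images back to Cauchy
  sequences, so its range inherits completeness from the domain.\<close>

lemma closed_range_analysis_op:
  assumes z: "frame ip z"
  shows "closed (range (analysis_op ip z))"
proof -
  obtain \<delta> where \<delta>: "\<delta> > 0" "\<And>h. \<delta> * norm h \<le> norm (analysis_op ip z h)"
    using frame_bounded_below[OF z] by blast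
  have "complete (range (analysis_op ip z))"
    by (rule complete_isometric_image[OF \<delta>(1)])
      (auto simp: \<delta>(2) bounded_linear_analysis_op frame_imp_bessel_seq[OF z]
        complete_eq_closed)
  then show ?thesis by (rule complete_imp_closed)
qed

lemma subspace_range_analysis_op:
  assumes z: "bessel_seq ip z"
  shows "module.subspace ell2_scale (range (analysis_op ip z))"
proof -
  \<comment> \<open>Makes the subspace notion of \<open>ell2_scale\<close> available in unfoldable
    form.\<close>
  interpret ell2: hilbert_space "ell2_scale :: 'k \<Rightarrow> _" ell2_ip
    by (rule hilbert_space_ell2)
  have "0 = analysis_op ip z 0"
    using linear_0[OF bounded_linear.linear[OF bounded_linear_analysis_op[OF z]]] by simp
  moreover have "analysis_op ip z g + analysis_op ip z h \<in> range (analysis_op ip z)" for g h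
    by (metis analysis_op_add[OF z] rangeI)
  moreover have "ell2_scale c (analysis_op ip z h) \<in> range (analysis_op ip z)" for c h
    by (metis analysis_op_scale[OF z] rangeI)
  ultimately show ?thesis
    unfolding ell2.subspace_def by blast
qed

section \<open>Normalized sequences and the diagonal operator\<close>

lemma power2_norm_le_bessel_bound:
  assumes z: "bessel_seq ip z" and B: "\<And>h. (\<Sum>n. (norm (ip h (z n)))\<^sup>2) \<le> B * (norm h)\<^sup>2"
    and "z n \<noteq> 0"
  shows "(norm (z n))\<^sup>2 \<le> B"
proof -
  \<comment> \<open>Take \<open>h = z n\<close> and keep only the term with index \<open>n\<close>:
    it is the fourth power of \<open>norm (z n)\<close>, and two of the factors cancel against the
    right-hand side.\<close>
  have "((norm (z n))\<^sup>2)\<^sup>2 = (norm (ip (z n) (z n)))\<^sup>2"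
    by (simp add: norm_ip[symmetric] norm_power)
  also have "\<dots> \<le> (\<Sum>m. (norm (ip (z n) (z m)))\<^sup>2)"
    using sum_le_suminf[of "\<lambda>m. (norm (ip (z n) (z m)))\<^sup>2" "{n}"]
      bessel_seq_imp_square_summable[OF z, of "z n"] by (simp add: square_summable_def)
  also have "\<dots> \<le> B * (norm (z n))\<^sup>2" by (rule B)
  finally show ?thesis
    using \<open>z n \<noteq> 0\<close> by (simp add: power2_eq_square)
qed

lemma frame_normalizedI:
  assumes x: "frame ip x" and nz: "\<And>n. x n \<noteq> 0"
    and y: "bessel_seq ip (\<lambda>n. x n /\<^sub>R norm (x n))"
  shows "frame ip (\<lambda>n. x n /\<^sub>R norm (x n))"
proof -
  let ?y = "\<lambda>n. x n /\<^sub>R norm (x n)"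
  obtain A where A: "A > 0" "\<And>h. A * (norm h)\<^sup>2 \<le> (\<Sum>n. (norm (ip h (x n)))\<^sup>2)"
    using frame_lower_bound[OF x] by blast
  obtain B where B: "B > 0" "\<And>h. (\<Sum>n. (norm (ip h (x n)))\<^sup>2) \<le> B * (norm h)\<^sup>2"
    using bessel_seq_bound[OF frame_imp_bessel_seq[OF x]] by blast
  obtain B' where B': "B' > 0" "\<And>h. (\<Sum>n. (norm (ip h (?y n)))\<^sup>2) \<le> B' * (norm h)\<^sup>2"
    using bessel_seq_bound[OF y] by blast
  have sum_y: "summable (\<lambda>n. (norm (ip h (?y n)))\<^sup>2)" for h
    using bessel_seq_imp_square_summable[OF y, of h] by (simp add: square_summable_def)
  \<comment> \<open>Each coefficient against \<open>x n\<close> is \<open>norm (x n)\<close> times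
    the one against \<open>?y n\<close>, so passing to \<open>?y\<close> costs at most the factor
    \<open>B\<close>.\<close>
  have lower: "A / B * (norm h)\<^sup>2 \<le> (\<Sum>n. (norm (ip h (?y n)))\<^sup>2)" for h
  proof -
    have "(norm (ip h (x n)))\<^sup>2 \<le> B * (norm (ip h (?y n)))\<^sup>2" for n
    proof -
      have "(norm (ip h (x n)))\<^sup>2 = (norm (x n))\<^sup>2 * (norm (ip h (?y n)))\<^sup>2"
        using nz[of n] by (simp add: ip_scaleR_right power_mult_distrib power_inverse)
      also have "\<dots> \<le> B * (norm (ip h (?y n)))\<^sup>2"
        by (intro mult_right_mono power2_norm_le_bessel_bound
            frame_imp_bessel_seq[OF x] B(2) nz) simp
      finally show ?thesis .
    qed
    then have "(\<Sum>n. (norm (ip h (x n)))\<^sup>2) \<le> (\<Sum>n. B * (norm (ip h (?y n)))\<^sup>2)"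
      using bessel_seq_imp_square_summable[OF frame_imp_bessel_seq[OF x], of h]
      by (intro suminf_le summable_mult sum_y) (simp_all add: square_summable_def)
    also have "\<dots> = B * (\<Sum>n. (norm (ip h (?y n)))\<^sup>2)"
      by (rule suminf_mult[OF sum_y])
    finally have "A * (norm h)\<^sup>2 \<le> B * (\<Sum>n. (norm (ip h (?y n)))\<^sup>2)"
      using A(2)[of h] by linarith
    then show ?thesis using B(1) by (simp add: field_simps)
  qed
  \<comment> \<open>A frame requires its lower constant not to exceed the upper one. In the zero
    space \<open>B'\<close> could lie below \<open>A / B\<close>, hence the maximum.\<close>
  have "(\<Sum>n. (norm (ip h (?y n)))\<^sup>2) \<le> max (A / B) B' * (norm h)\<^sup>2" for h
    using B'(2)[of h] mult_right_mono[of B' "max (A / B) B'" "(norm h)\<^sup>2"] by simp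
  then show ?thesis
    unfolding frame_def using A(1) B(1) lower sum_y
    by (intro exI[of _ "A / B"] exI[of _ "max (A / B) B'"]) auto
qed

text \<open>The coordinate form of the factorization of the analysis operator of the normalized
  sequence. The weight is real, so no conjugate appears when it moves into the second
  argument.\<close>

lemma mult_ip_normalized:
  "of_real (1 / norm (x n)) * ip h (x n) = ip h (x n /\<^sub>R norm (x n))"
  by (simp add: ip_scaleR_right scaleR_conv_of_real divide_inverse)

text \<open>Inclusion in the domain is square summability of the normalized coefficients, vector by
  vector; \<open>bessel_seqI_square_summable\<close> turns this into one bound for all
  vectors.\<close>

lemma range_analysis_op_subset_diag_dom_iff:
  assumes "bessel_seq ip x"
  shows "range (analysis_op ip x) \<subseteq> diag_dom (\<lambda>n. of_real (1 / norm (x n)))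
    \<longleftrightarrow> bessel_seq ip (\<lambda>n. x n /\<^sub>R norm (x n))"
  unfolding image_subset_iff
    analysis_op_in_diag_dom_iff[where ip = ip, OF bessel_seq_imp_square_summable[OF assms]]
    mult_ip_normalized
  by (auto intro: bessel_seqI_square_summable bessel_seq_imp_square_summable)

lemma ICR_on_diag_op_range_analysis_op:
  assumes x: "frame ip x" and nz: "\<And>n. x n \<noteq> 0"
    and y: "frame ip (\<lambda>n. x n /\<^sub>R norm (x n))"
  shows "ICR_on ell2_scale ell2_scale (range (analysis_op ip x))
    (diag_op (\<lambda>n. of_real (1 / norm (x n))))"
proof -
  define D where "D = diag_op (\<lambda>n. of_real (1 / norm (x n)) :: 'k)"
  let ?C = "analysis_op ip x"
  let ?F = "analysis_op ip (\<lambda>n. x n /\<^sub>R norm (x n))"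
  note bx = frame_imp_bessel_seq[OF x] and bF = frame_imp_bessel_seq[OF y]
  have D: "D (?C h) = ?F h" for h
    unfolding D_def diag_op_analysis_op[where ip = ip, OF bessel_seq_imp_square_summable[OF bx]]
      mult_ip_normalized by (simp add: analysis_op_def)
  obtain K where K: "K \<ge> 0" "\<And>h. norm (?F h) \<le> K * norm h"
    using bounded_linear.nonneg_bounded[OF bounded_linear_analysis_op[OF bF]]
    by (auto simp: mult.commute)
  obtain \<delta> where \<delta>: "\<delta> > 0" "\<And>h. \<delta> * norm h \<le> norm (?C h)"
    using frame_bounded_below[OF x] by blast
  \<comment> \<open>Boundedness of \<open>D\<close> must be measured against
    \<open>norm (?C h)\<close>, not \<open>norm h\<close>; the lower frame bound of \<open>x\<close>
    converts one into the other.\<close>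
  have bound: "norm (?F h) \<le> (K / \<delta>) * norm (?C h)" for h
  proof -
    have "norm h \<le> norm (?C h) / \<delta>" using \<delta> by (simp add: field_simps)
    then show ?thesis using K(2)[of h] mult_left_mono[OF _ K(1)] by fastforce
  qed
  \<comment> \<open>Coordinatewise: \<open>x n\<close> and its normalization differ by a nonzero
    real factor, so equal coefficients against one are equal against the other.\<close>
  have inj: "?C g = ?C h" if "?F g = ?F h" for g h
  proof (rule ell2_eqI)
    fix n
    have "ip g (x n /\<^sub>R norm (x n)) = ip h (x n /\<^sub>R norm (x n))"
      using ell2_nth_analysis_op[OF bF] that by metis
    then show "ell2_nth (?C g) n = ell2_nth (?C h) n"
      using nz[of n] by (simp add: ell2_nth_analysis_op[OF bx] ip_scaleR_right)
  qed
  show ?thesis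
    unfolding ICR_on_def D_def[symmetric]
  proof (intro conjI ballI allI)
    show "module.subspace ell2_scale (range ?C)"
      by (rule subspace_range_analysis_op[OF bx])
    show "D (d + e) = D d + D e" if "d \<in> range ?C" "e \<in> range ?C" for d e
      using that by (auto simp: D analysis_op_add[OF bF] simp flip: analysis_op_add[OF bx])
    show "D (ell2_scale c d) = ell2_scale c (D d)" if "d \<in> range ?C" for c d
      using that by (auto simp: D analysis_op_scale[OF bF] simp flip: analysis_op_scale[OF bx])
    show "\<exists>K. \<forall>d\<in>range ?C. norm (D d) \<le> K * norm d"
    proof (intro exI ballI)
      fix d assume "d \<in> range ?C"
      then obtain h where "d = ?C h" by blast
      then show "norm (D d) \<le> (K / \<delta>) * norm d" by (simp only: D bound)
    qed
    show "inj_on D (range ?C)"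
    proof (rule inj_onI)
      fix d e assume "d \<in> range ?C" "e \<in> range ?C" and de: "D d = D e"
      then obtain g h where gh: "d = ?C g" "e = ?C h" by blast
      show "d = e" using de unfolding gh D by (rule inj)
    qed
    have "D ` range ?C = range ?F" by (simp add: D image_image)
    then show "closed (D ` range ?C)" using closed_range_analysis_op[OF y] by simp
  qed
qed

end

theorem proposition3p10:
  fixes scale :: "'k::rc_field \<Rightarrow> 'h::banach \<Rightarrow> 'h"
    and ip :: "'h \<Rightarrow> 'h \<Rightarrow> 'k"
    and x :: "nat \<Rightarrow> 'h"
    and C :: "'h \<Rightarrow> 'k ell2"
    and \<alpha> :: "nat \<Rightarrow> 'k"
  assumes "hilbert_space scale ip"
    and "separable_space (euclidean :: 'h topology)"
    and "frame ip x"
    and "\<And>n. x n \<noteq> 0"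
  defines "C \<equiv> analysis_op ip x"
    and "\<alpha> \<equiv> \<lambda>n. of_real (1 / norm (x n))"
  shows
    "(bessel_seq ip (\<lambda>n. x n /\<^sub>R norm (x n)) \<longleftrightarrow> frame ip (\<lambda>n. x n /\<^sub>R norm (x n))) \<and>
     (frame ip (\<lambda>n. x n /\<^sub>R norm (x n)) \<longleftrightarrow>
        range C \<subseteq> diag_dom \<alpha> \<and> ICR_on ell2_scale ell2_scale (range C) (diag_op \<alpha>)) \<and>
     (range C \<subseteq> diag_dom \<alpha> \<and> ICR_on ell2_scale ell2_scale (range C) (diag_op \<alpha>) \<longleftrightarrow>
        range C \<subseteq> diag_dom \<alpha>)"
proof -
  interpret hilbert_space scale ip by fact
  \<comment> \<open>(a) and (b) imply each other, (a) is equivalent to (d), (b) yields the ICR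
    property in (c), and (d) is a conjunct of (c).\<close>
  show ?thesis
    using frame_imp_bessel_seq[of ip "\<lambda>n. x n /\<^sub>R norm (x n)"]
      frame_normalizedI[OF assms(3,4)]
      range_analysis_op_subset_diag_dom_iff[OF frame_imp_bessel_seq[OF assms(3)]]
      ICR_on_diag_op_range_analysis_op[OF assms(3,4)]
    unfolding C_def \<alpha>_def by blast
qed

end
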